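(* Let $\Lambda$ be a nonempty set, and for each $\lambda\in\Lambda$ let $n(\lambda)\in\mathbb{N}\cup\{\infty\}$ and let $\alpha(\lambda,k)$, $k\in I_{n(\lambda)}$, be a strictly increasing (finite or infinite) sequence of positive numbers. Let $X_\lambda=Exp(\alpha(\lambda,k)\mid k\in I_{n(\lambda)})\subset C_\infty[0,\infty)$ and $\beta(\lambda)=\sum_{k\in I_{n(\lambda)}}\frac{1}{\alpha(\lambda,k)}$, and assume $\beta(\lambda)<\infty$ for every $\lambda\in\Lambda$. Suppose that $\inf_{\lambda\in\Lambda}\alpha(\lambda,1)>0$. If the family of numbers $\beta(\lambda)$, $\lambda\in\Lambda$, is unbounded, then the family $(X_\lambda)_{\lambda\in\Lambda}$ is an absolutely representing family of subspaces (ARFS) in $C_\infty[0,\infty)$.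
   Context: $\mathbb{K}$ is $\mathbb{R}$ or $\mathbb{C}$. $C_\infty[0,\infty)$ is the Banach space of all continuous functions $f:[0,\infty)\to\mathbb{K}$ with $\lim_{t\to\infty}f(t)=0$, with norm $\|f\|=\sup_{t\geqslant 0}|f(t)|$. $I_n=\{1,\ldots,n\}$ for $n\in\mathbb{N}$, and $I_\infty=\{1,2,\ldots\}$. For pairwise distinct positive numbers $\alpha_k$, $k\in I_n$ ($n\in\mathbb{N}\cup\{\infty\}$), $Exp(\alpha_k\mid k\in I_n)$ is the closed linear span in $C_\infty[0,\infty)$ of the functions $t\mapsto e^{-\alpha_k t}$, $k\in I_n$. A family $(X_\lambda)_{\lambda\in\Lambda}$ of closed linear subspaces of a Banach space $X$ is an absolutely representing family of subspaces (ARFS) in $X$ if for every $x\in X$ there exist $x_\lambda\in X_\lambda$, $\lambda\in\Lambda$, such that $\sum_{\lambda\in\Lambda}\|x_\lambda\|<\infty$ and $x=\sum_{\lambda\in\Lambda}x_\lambda$. The family $\beta(\lambda)$ is unbounded if there is no real $C$ with $\beta(\lambda)\leqslant C$ for all $\lambda\in\Lambda$. *)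

theory Defs
  imports "HOL-Analysis.Analysis" "HOL-Library.Extended_Nat"
begin

text \<open>
  The space of continuous functions on \<open>[0,\<infinity>)\<close> tending to \<open>0\<close> at infinity. An element is
  represented by its extension by \<open>0\<close> to the negative reals, so that equality of
  representatives is equality on \<open>[0,\<infinity>)\<close>.
\<close>

typedef (overloaded) 'a C_infty =
  "{f :: real \<Rightarrow> 'a::real_normed_vector.
      continuous_on {0..} f \<and> (f \<longlongrightarrow> 0) at_top \<and> (\<forall>t<0. f t = 0)}"
  morphisms c_apply Abs_C_infty
  by (rule exI[of _ "\<lambda>_. 0"]) auto

setup_lifting type_definition_C_infty

lemma c_apply_cont: "continuous_on {0..} (c_apply f)"
  and c_apply_lim: "(c_apply f \<longlongrightarrow> 0) at_top"
  and c_apply_neg: "t < 0 \<Longrightarrow> c_apply f t = 0"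
  using c_apply[of f] by auto

lemma C_infty_eqI: "(\<And>t. t \<ge> 0 \<Longrightarrow> c_apply f t = c_apply g t) \<Longrightarrow> f = g"
  by (metis c_apply_inject c_apply_neg ext not_less)

lemma c_apply_bounded: "bounded (c_apply f ` {0..})"
proof -
  have "\<forall>\<^sub>F t in at_top. norm (c_apply f t) < 1"
    using tendstoD[OF c_apply_lim, of 1] by simp
  then obtain T where T: "\<And>t. t \<ge> T \<Longrightarrow> norm (c_apply f t) < 1"
    by (auto simp: eventually_at_top_linorder)
  have "compact (c_apply f ` {0..T})"
    by (intro compact_continuous_image continuous_on_subset[OF c_apply_cont]) auto
  then obtain B where B: "\<And>t. t \<in> {0..T} \<Longrightarrow> norm (c_apply f t) \<le> B"
    by (meson bounded_iff compact_imp_bounded imageI)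
  have "norm (c_apply f t) \<le> max B 1" if "t \<ge> 0" for t
    using T[of t] B[of t] that by (cases "t \<le> T") (auto simp: le_max_iff_disj)
  then show ?thesis
    by (auto simp: bounded_iff)
qed

instantiation C_infty :: (real_normed_vector) real_vector
begin

lift_definition zero_C_infty :: "'a C_infty" is "\<lambda>_. 0" by simp

lift_definition plus_C_infty :: "'a C_infty \<Rightarrow> 'a C_infty \<Rightarrow> 'a C_infty" is "\<lambda>f g t. f t + g t"
  using tendsto_add by (fastforce intro: continuous_intros)

lift_definition uminus_C_infty :: "'a C_infty \<Rightarrow> 'a C_infty" is "\<lambda>f t. - f t"
  using tendsto_minus by (fastforce intro: continuous_intros)

lift_definition minus_C_infty :: "'a C_infty \<Rightarrow> 'a C_infty \<Rightarrow> 'a C_infty" is "\<lambda>f g t. f t - g t"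
  using tendsto_diff by (fastforce intro: continuous_intros)

lift_definition scaleR_C_infty :: "real \<Rightarrow> 'a C_infty \<Rightarrow> 'a C_infty" is "\<lambda>r f t. r *\<^sub>R f t"
  using tendsto_scaleR[OF tendsto_const] by (fastforce intro: continuous_intros)

instance
  by standard (transfer; force simp: algebra_simps)+

end

instantiation C_infty :: (real_normed_vector) real_normed_vector
begin

definition norm_C_infty :: "'a C_infty \<Rightarrow> real" where
  "norm_C_infty f = (SUP t\<in>{0..}. norm (c_apply f t))"

definition dist_C_infty :: "'a C_infty \<Rightarrow> 'a C_infty \<Rightarrow> real" where
  "dist_C_infty f g = norm (f - g)"

definition sgn_C_infty :: "'a C_infty \<Rightarrow> 'a C_infty" where
  "sgn_C_infty f = inverse (norm f) *\<^sub>R f"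

definition uniformity_C_infty :: "('a C_infty \<times> 'a C_infty) filter" where
  "uniformity_C_infty = (INF e\<in>{0<..}. principal {(x, y). dist x y < e})"

definition open_C_infty :: "'a C_infty set \<Rightarrow> bool" where
  "open_C_infty S \<longleftrightarrow> (\<forall>x\<in>S. \<forall>\<^sub>F (x', y) in uniformity. x' = x \<longrightarrow> y \<in> S)"

lemma C_infty_norm_upper: "t \<ge> 0 \<Longrightarrow> norm (c_apply f t) \<le> norm f"
  unfolding norm_C_infty_def
proof (rule cSUP_upper)
  show "bdd_above ((\<lambda>t. norm (c_apply f t)) ` {0..})"
    using c_apply_bounded[of f] by (auto simp: bounded_iff bdd_above_def)
qed simp

lemma C_infty_norm_least: "(\<And>t. t \<ge> 0 \<Longrightarrow> norm (c_apply f t) \<le> B) \<Longrightarrow> norm f \<le> B"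
  unfolding norm_C_infty_def by (rule cSUP_least) auto

instance
proof
  fix f g :: "'a C_infty" and a :: real
  show "dist f g = norm (f - g)" "sgn f = f /\<^sub>R norm f"
    by (simp_all add: dist_C_infty_def sgn_C_infty_def)
  show "uniformity = (INF e\<in>{0<..}. principal {(x, y). dist (x::'a C_infty) y < e})"
    by (rule uniformity_C_infty_def)
  show "open U = (\<forall>x\<in>U. \<forall>\<^sub>F (x', y) in uniformity. x' = x \<longrightarrow> y \<in> U)" for U :: "'a C_infty set"
    by (rule open_C_infty_def)
  show "norm f = 0 \<longleftrightarrow> f = 0"
  proof
    assume "norm f = 0"
    then have "c_apply f t = c_apply 0 t" if "t \<ge> 0" for t
      using C_infty_norm_upper[OF that, of f] by (simp add: zero_C_infty.rep_eq)
    then show "f = 0" by (rule C_infty_eqI)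
  qed (simp add: norm_C_infty_def zero_C_infty.rep_eq)
  show "norm (f + g) \<le> norm f + norm g"
    by (rule C_infty_norm_least)
      (auto simp: plus_C_infty.rep_eq intro!: norm_triangle_le add_mono C_infty_norm_upper)
  have le: "norm (c *\<^sub>R h) \<le> \<bar>c\<bar> * norm h" for c :: real and h :: "'a C_infty"
    by (rule C_infty_norm_least)
      (auto simp: scaleR_C_infty.rep_eq intro!: mult_left_mono C_infty_norm_upper)
  show "norm (a *\<^sub>R f) = \<bar>a\<bar> * norm f"
  proof (cases "a = 0")
    case True
    have "0 \<le> norm (a *\<^sub>R f)"
      by (rule order_trans[OF norm_ge_zero C_infty_norm_upper[of 0]]) simp
    then show ?thesis using le[of a f] True by simp
  next
    case False
    have "inverse a *\<^sub>R a *\<^sub>R f = f"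
      using False by transfer auto
    then have "norm f \<le> \<bar>inverse a\<bar> * norm (a *\<^sub>R f)"
      using le[of "inverse a" "a *\<^sub>R f"] by simp
    then have "\<bar>a\<bar> * norm f \<le> norm (a *\<^sub>R f)"
      using False by (simp add: field_simps)
    then show ?thesis using le[of a f] by simp
  qed
qed

end

instance C_infty :: (banach) banach
proof
  fix X :: "nat \<Rightarrow> 'a C_infty"
  assume X: "Cauchy X"
  have near: "norm (c_apply f t - c_apply g t) \<le> dist f g" for f g :: "'a C_infty" and t
    using C_infty_norm_upper[of t "f - g"]
    by (cases "t \<ge> 0") (auto simp: dist_norm minus_C_infty.rep_eq c_apply_neg)
  have "Cauchy (\<lambda>n. c_apply (X n) t)" for t
  proof (rule metric_CauchyI)
    fix e :: real assume "0 < e"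
    then obtain N where "\<And>m n. m \<ge> N \<Longrightarrow> n \<ge> N \<Longrightarrow> dist (X m) (X n) < e"
      using metric_CauchyD[OF X \<open>0 < e\<close>] by blast
    then show "\<exists>M. \<forall>m\<ge>M. \<forall>n\<ge>M. dist (c_apply (X m) t) (c_apply (X n) t) < e"
      by (metis dist_norm near order_le_less_trans)
  qed
  then have "\<forall>t. \<exists>l. (\<lambda>n. c_apply (X n) t) \<longlonglongrightarrow> l"
    using Cauchy_convergent convergent_def by blast
  then obtain g where g: "\<And>t. (\<lambda>n. c_apply (X n) t) \<longlonglongrightarrow> g t"
    by metis
  have close: "\<exists>N. \<forall>n\<ge>N. \<forall>t. norm (c_apply (X n) t - g t) \<le> e" if "e > 0" for e
  proof -
    obtain N where N: "\<And>m n. m \<ge> N \<Longrightarrow> n \<ge> N \<Longrightarrow> dist (X m) (X n) < e"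
      using metric_CauchyD[OF X \<open>e > 0\<close>] by blast
    have "norm (c_apply (X n) t - g t) \<le> e" if "n \<ge> N" for n t
    proof (rule tendsto_upperbound)
      show "(\<lambda>m. norm (c_apply (X n) t - c_apply (X m) t)) \<longlonglongrightarrow> norm (c_apply (X n) t - g t)"
        by (intro tendsto_intros g)
      show "\<forall>\<^sub>F m in sequentially. norm (c_apply (X n) t - c_apply (X m) t) \<le> e"
        unfolding eventually_sequentially
        using N[OF that] near by (meson less_imp_le order_trans)
    qed simp
    then show ?thesis by blast
  qed
  have unif: "uniform_limit UNIV (\<lambda>n. c_apply (X n)) g sequentially"
  proof (rule uniform_limitI)
    fix e :: real assume "0 < e"
    then obtain N where "\<forall>n\<ge>N. \<forall>t. norm (c_apply (X n) t - g t) \<le> e / 2"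
      using close[of "e / 2"] by auto
    then have "\<forall>n\<ge>N. \<forall>t\<in>UNIV. dist (c_apply (X n) t) (g t) < e"
      using \<open>0 < e\<close> by (auto simp: dist_norm intro: order_le_less_trans[where y = "e / 2"])
    then show "\<forall>\<^sub>F n in sequentially. \<forall>t\<in>UNIV. dist (c_apply (X n) t) (g t) < e"
      unfolding eventually_sequentially by blast
  qed
  have g_cont: "continuous_on {0..} g"
    by (rule uniform_limit_theorem[OF _ uniform_limit_on_subset[OF unif]])
      (auto intro!: always_eventually c_apply_cont)
  have g_lim: "(g \<longlongrightarrow> 0) at_top"
    by (rule swap_uniform_limit'[where f = "\<lambda>n. c_apply (X n)" and g = "\<lambda>_. 0" and F = sequentially and S = UNIV])
      (auto intro!: always_eventually c_apply_lim unif)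
  have g_neg: "g t = 0" if "t < 0" for t
    using g[of t] that by (simp add: c_apply_neg LIMSEQ_const_iff)
  define G where "G = Abs_C_infty g"
  have G: "c_apply G = g"
    unfolding G_def using g_cont g_lim g_neg by (intro Abs_C_infty_inverse) auto
  have "X \<longlonglongrightarrow> G"
  proof (rule metric_LIMSEQ_I)
    fix e :: real assume "0 < e"
    then obtain N where N: "\<forall>n\<ge>N. \<forall>t. norm (c_apply (X n) t - g t) \<le> e / 2"
      using close[of "e / 2"] by auto
    have "dist (X n) G \<le> e / 2" if "n \<ge> N" for n
      unfolding dist_norm using N that
      by (intro C_infty_norm_least) (auto simp: minus_C_infty.rep_eq G)
    then show "\<exists>N. \<forall>n\<ge>N. dist (X n) G < e"
      using \<open>0 < e\<close> by (intro exI[of _ N]) fastforce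
  qed
  then show "convergent X" by (rule convergentI)
qed

text \<open>
  Multiplication by scalars of the field \<open>'a\<close> in which the functions take their values:
  \<open>*\<^sub>R\<close> yields only the real structure, also for complex-valued functions.
\<close>

lift_definition c_scale :: "'a::real_normed_field \<Rightarrow> 'a C_infty \<Rightarrow> 'a C_infty" is "\<lambda>c f t. c * f t"
  using tendsto_mult_right_zero by (fastforce intro: continuous_intros)

lemma vector_space_c_scale:
  "vector_space (c_scale :: 'a::real_normed_field \<Rightarrow> 'a C_infty \<Rightarrow> 'a C_infty)"
  by unfold_locales (transfer; force simp: algebra_simps)+

lemma norm_c_scale: "norm (c_scale c f) = norm c * norm f"
proof -
  have le: "norm (c_scale c f) \<le> norm c * norm f" for c :: 'a and f
    by (rule C_infty_norm_least)
      (auto simp: c_scale.rep_eq norm_mult intro!: mult_left_mono C_infty_norm_upper)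
  show ?thesis
  proof (cases "c = 0")
    case True
    then show ?thesis using le[of c f] by simp
  next
    case False
    have "c_scale (inverse c) (c_scale c f) = f"
      using False by transfer auto
    then have "norm f \<le> norm (inverse c) * norm (c_scale c f)"
      using le[of "inverse c" "c_scale c f"] by simp
    then have "norm c * norm f \<le> norm (c_scale c f)"
      using False by (simp add: nonzero_norm_inverse del: inverse_eq_divide) (simp add: field_simps)
    then show ?thesis using le[of c f] by simp
  qed
qed

text \<open>The function \<open>t \<mapsto> exp (- a t)\<close>; it belongs to the space only for \<open>a > 0\<close>.\<close>

definition exp_fun :: "real \<Rightarrow> 'a::real_normed_field C_infty" where
  "exp_fun a = Abs_C_infty (\<lambda>t. if t \<ge> 0 then of_real (exp (- a * t)) else 0)"

lemma c_apply_exp_fun: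
  assumes "a > 0" and "t \<ge> 0"
  shows "c_apply (exp_fun a :: 'a::real_normed_field C_infty) t = of_real (exp (- a * t))"
proof -
  let ?f = "\<lambda>t. if t \<ge> 0 then of_real (exp (- a * t)) else 0 :: 'a"
  have "continuous_on {0..} (\<lambda>t. of_real (exp (- a * t)) :: 'a)"
    by (intro continuous_intros)
  then have "continuous_on {0..} ?f"
    by (rule continuous_on_eq) auto
  moreover have "((\<lambda>t. of_real (exp (- a * t)) :: 'a) \<longlongrightarrow> of_real 0) at_top"
  proof (rule tendsto_of_real, rule filterlim_compose[OF exp_at_bot])
    show "filterlim (\<lambda>t. - a * t) at_bot at_top"
      using assms(1) by (intro filterlim_tendsto_neg_mult_at_bot[OF tendsto_const]) (auto simp: filterlim_ident)
  qed
  then have "(?f \<longlongrightarrow> 0) at_top"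
    unfolding of_real_0
    by (rule Lim_transform_eventually) (auto intro: eventually_at_top_linorderI[of 0])
  ultimately have "c_apply (exp_fun a :: 'a C_infty) = ?f"
    unfolding exp_fun_def by (intro Abs_C_infty_inverse) auto
  then show ?thesis using assms by simp
qed

definition idx_set :: "enat \<Rightarrow> nat set" where
  "idx_set n = {k. 1 \<le> k \<and> enat k \<le> n}"

definition Exp_space :: "(nat \<Rightarrow> real) \<Rightarrow> nat set \<Rightarrow> 'a::real_normed_field C_infty set" where
  "Exp_space a K = closure (module.span c_scale ((\<lambda>k. exp_fun (a k)) ` K))"

text \<open>
  Absolutely representing families of subspaces of a Banach space over \<open>'k\<close>, whose scalar
  multiplication is the parameter \<open>smul\<close> (on a type of class \<open>banach\<close> only the real one is fixed).
\<close>

definition arfs ::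
  "('k::real_normed_field \<Rightarrow> 'x::banach \<Rightarrow> 'x) \<Rightarrow> 'i set \<Rightarrow> ('i \<Rightarrow> 'x set) \<Rightarrow> bool" where
  "arfs smul L X \<longleftrightarrow>
     (\<forall>l\<in>L. closed (X l) \<and> module.subspace smul (X l)) \<and>
     (\<forall>x. \<exists>y. (\<forall>l\<in>L. y l \<in> X l) \<and> (\<lambda>l. norm (y l)) summable_on L \<and> (y has_sum x) L)"

end

theory Submission
  imports Defs
begin

text \<open>
  Write \<open>e\<^sub>c\<close> for the function \<open>t \<mapsto> exp (- c t)\<close>. A construction due to von Golitschek bounds the distance from
  \<open>e\<^sub>c\<close> to the span of finitely many \<open>e\<^sub>\<mu>\<close> by the product of the factors \<open>\<bar>1 - c / \<mu>\<bar>\<close>. If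
  \<open>c \<le> inf \<alpha>(\<lambda>,1)\<close>, these factors are at most \<open>exp (- c / \<mu>)\<close>, so \<open>e\<^sub>c\<close> is within \<open>exp (- c \<beta>(\<lambda>))\<close> of
  \<open>X\<^sub>\<lambda>\<close>. The functions whose distance to \<open>X\<^sub>\<lambda>\<close> tends to \<open>0\<close> as \<open>\<beta>(\<lambda>) \<rightarrow> \<infinity>\<close> form a closed subspace; the
  same bound, with many \<open>\<mu>\<close> slightly below \<open>d\<close>, enlarges the range of \<open>c\<close> with \<open>e\<^sub>c\<close> in this subspace
  from \<open>(0,d]\<close> to \<open>(0,3d/2]\<close>, hence to all \<open>c > 0\<close>. By Stone--Weierstrass the subspace is everything.
  A greedy choice of approximants from \<open>X\<^sub>\<lambda>\<close> for pairwise distinct \<open>\<lambda>\<close>, with geometrically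
  decreasing remainders, then represents any function.
\<close>

section \<open>Approximating one exponential by finitely many others\<close>

text \<open>Induction on \<open>F\<close>. Convolution with
  \<open>(\<nu> - c) * exp (- \<nu> * t)\<close> turns \<open>exp (- \<mu> * t)\<close>, \<mu>
  different from \<nu>, into a multiple of \<open>exp (- \<mu> * t) - exp (- \<nu> * t)\<close>, and
  \<open>exp (- c * t)\<close> into \<open>exp (- c * t) - exp (- \<nu> * t)\<close>. It therefore
  maps a remainder for \<open>F\<close> to one for \<open>insert \<nu> F\<close>, at the cost of one
  factor.\<close>

lemma exp_approx_finite_set:
  fixes c :: real
  assumes "finite F" and "\<And>\<mu>. \<mu> \<in> F \<Longrightarrow> 0 < \<mu>" and "0 \<le> c"
  shows "\<exists>a. \<forall>t\<ge>0. \<bar>exp (- c * t) - (\<Sum>\<mu>\<in>F. a \<mu> * exp (- \<mu> * t))\<bar> \<le> (\<Prod>\<mu>\<in>F. \<bar>1 - c / \<mu>\<bar>)"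
  using assms(1,2)
proof (induction F rule: finite_induct)
  case empty
  then show ?case using \<open>0 \<le> c\<close> by auto
next
  case (insert \<nu> F)
  define M where "M = (\<Prod>\<mu>\<in>F. \<bar>1 - c / \<mu>\<bar>)"
  obtain a where a: "\<And>t. t \<ge> 0 \<Longrightarrow> \<bar>exp (- c * t) - (\<Sum>\<mu>\<in>F. a \<mu> * exp (- \<mu> * t))\<bar> \<le> M"
    using insert unfolding M_def by auto
  have "0 < \<nu>" using insert.prems by simp
  \<comment> \<open>The new remainder is \<open>(\<nu> - c) \<integral>\<^sub>0\<^sup>t exp (- \<nu> (t - s)) Q s ds = exp (- \<nu> t) h t\<close>, whose sup norm is at
    most \<open>\<bar>\<nu> - c\<bar> / \<nu>\<close> times that of the old remainder \<open>Q\<close>.\<close>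
  define b where "b \<mu> = a \<mu> * (\<nu> - c) / (\<nu> - \<mu>)" for \<mu>
  define Q where "Q t = exp (- c * t) - (\<Sum>\<mu>\<in>F. a \<mu> * exp (- \<mu> * t))" for t
  define h where "h t = (exp ((\<nu> - c) * t) - 1) - (\<Sum>\<mu>\<in>F. b \<mu> * (exp ((\<nu> - \<mu>) * t) - 1))" for t
  \<comment> \<open>The coefficient at \<nu> gathers all terms in \<open>exp (- \<nu> * t)\<close>;
    it makes the new remainder vanish at \<open>t = 0\<close>.\<close>
  define d where "d = (b(\<nu> := 1 - sum b F))"
  have sumd: "(\<Sum>\<mu>\<in>F. d \<mu> * exp (- \<mu> * t)) = (\<Sum>\<mu>\<in>F. b \<mu> * exp (- \<mu> * t))" for t
    using insert.hyps by (intro sum.cong) (auto simp: d_def)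
  have R: "exp (- c * t) - (\<Sum>\<mu>\<in>insert \<nu> F. d \<mu> * exp (- \<mu> * t)) = exp (- \<nu> * t) * h t" for t
  proof -
    have "exp (- c * t) - (\<Sum>\<mu>\<in>insert \<nu> F. d \<mu> * exp (- \<mu> * t))
        = exp (- c * t) - (d \<nu> * exp (- \<nu> * t) + (\<Sum>\<mu>\<in>F. b \<mu> * exp (- \<mu> * t)))"
      unfolding sum.insert[OF insert.hyps(1,2)] sumd ..
    also have "d \<nu> = 1 - sum b F" by (simp add: d_def)
    also have "exp (- c * t) - ((1 - sum b F) * exp (- \<nu> * t) + (\<Sum>\<mu>\<in>F. b \<mu> * exp (- \<mu> * t)))
        = exp (- \<nu> * t) * h t"
      by (simp add: h_def algebra_simps sum_distrib_left sum_subtractf flip: exp_add)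
    finally show ?thesis .
  qed
  have der: "(h has_real_derivative (\<nu> - c) * exp (\<nu> * t) * Q t) (at t)" for t
  proof -
    have "(h has_real_derivative exp ((\<nu> - c) * t) * (\<nu> - c)
        - (\<Sum>\<mu>\<in>F. b \<mu> * (exp ((\<nu> - \<mu>) * t) * (\<nu> - \<mu>)))) (at t)"
      unfolding h_def by (auto intro!: derivative_eq_intros sum.cong)
    moreover have "(\<Sum>\<mu>\<in>F. b \<mu> * (exp ((\<nu> - \<mu>) * t) * (\<nu> - \<mu>)))
        = (\<nu> - c) * exp (\<nu> * t) * (\<Sum>\<mu>\<in>F. a \<mu> * exp (- \<mu> * t))"
      unfolding sum_distrib_left
    proof (rule sum.cong)
      fix \<mu> assume "\<mu> \<in> F"
      then have "\<nu> \<noteq> \<mu>" using insert.hyps by auto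
      then show "b \<mu> * (exp ((\<nu> - \<mu>) * t) * (\<nu> - \<mu>)) = (\<nu> - c) * exp (\<nu> * t) * (a \<mu> * exp (- \<mu> * t))"
        by (simp add: b_def left_diff_distrib exp_diff exp_minus field_simps)
    qed simp
    moreover have "exp ((\<nu> - c) * t) * (\<nu> - c) = (\<nu> - c) * exp (\<nu> * t) * exp (- c * t)"
      by (simp add: algebra_simps flip: exp_add)
    ultimately show ?thesis
      unfolding Q_def right_diff_distrib by simp
  qed
  define K where "K = \<bar>\<nu> - c\<bar> * M / \<nu>"
  have hb: "\<bar>h t\<bar> \<le> K * (exp (\<nu> * t) - 1)" if "t \<ge> 0" for t
  proof -
    have bnd: "\<bar>(\<nu> - c) * exp (\<nu> * s) * Q s\<bar> \<le> K * \<nu> * exp (\<nu> * s)" if "s \<ge> 0" for s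
      using mult_left_mono[OF a[OF that], of "\<bar>\<nu> - c\<bar> * exp (\<nu> * s)"] \<open>0 < \<nu>\<close>
      by (simp add: K_def Q_def abs_mult mult_ac)
    \<comment> \<open>Comparing derivatives replaces estimating an integral: \<open>bnd\<close>
      bounds the derivative of \<open>h\<close> by that of \<open>K * exp (\<nu> * t)\<close>. The
      two signs \<sigma> give the two halves of the absolute value, and
      \<open>h 0 = 0\<close>.\<close>
    have "K * exp (\<nu> * 0) - \<sigma> * h 0 \<le> K * exp (\<nu> * t) - \<sigma> * h t" if "\<bar>\<sigma>\<bar> = 1" for \<sigma>
    proof (rule DERIV_nonneg_imp_nondecreasing[OF \<open>t \<ge> 0\<close>])
      fix s :: real assume "0 \<le> s"
      have "((\<lambda>t. K * exp (\<nu> * t) - \<sigma> * h t) has_real_derivative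
          K * \<nu> * exp (\<nu> * s) - \<sigma> * ((\<nu> - c) * exp (\<nu> * s) * Q s)) (at s)"
        by (auto intro!: derivative_eq_intros der)
      moreover have "\<sigma> * ((\<nu> - c) * exp (\<nu> * s) * Q s) \<le> K * \<nu> * exp (\<nu> * s)"
        using bnd[OF \<open>0 \<le> s\<close>] that by (metis abs_le_D1 abs_mult mult_1)
      ultimately show "\<exists>y. ((\<lambda>t. K * exp (\<nu> * t) - \<sigma> * h t) has_real_derivative y) (at s) \<and> 0 \<le> y"
        by (metis diff_ge_0_iff_ge)
    qed
    from this[of 1] this[of "-1"] show ?thesis
      by (simp add: h_def algebra_simps)
  qed
  have "0 \<le> K" unfolding K_def M_def using \<open>0 < \<nu>\<close> by (simp add: prod_nonneg)
  have "\<bar>exp (- \<nu> * t) * h t\<bar> \<le> K" if "t \<ge> 0" for t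
  proof -
    have "\<bar>exp (- \<nu> * t) * h t\<bar> \<le> exp (- \<nu> * t) * (K * (exp (\<nu> * t) - 1))"
      unfolding abs_mult by (intro mult_mono hb that) auto
    also have "\<dots> = K - K * exp (- \<nu> * t)"
      by (simp add: algebra_simps flip: exp_add)
    also have "\<dots> \<le> K" using \<open>0 \<le> K\<close> by simp
    finally show ?thesis .
  qed
  moreover have "K = (\<Prod>\<mu>\<in>insert \<nu> F. \<bar>1 - c / \<mu>\<bar>)"
    using insert.hyps \<open>0 < \<nu>\<close> by (simp add: K_def M_def diff_divide_distrib flip: abs_divide)
       (simp add: divide_simps abs_if)
  ultimately show ?case using R by metis
qed

interpretation C_infty: vector_space "c_scale :: 'a::real_normed_field \<Rightarrow> _"
  by (rule vector_space_c_scale)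

lemma c_apply_sum: "c_apply (\<Sum>i\<in>A. f i) t = (\<Sum>i\<in>A. c_apply (f i) t)"
  by (induction A rule: infinite_finite_induct) (simp_all add: zero_C_infty.rep_eq plus_C_infty.rep_eq)

text \<open>Stated for any subspace because it is applied both to a single space of the family and
  to the subspace of asymptotically approximable functions.\<close>

lemma exp_fun_approx_subspace:
  fixes V :: "'a::real_normed_field C_infty set"
  assumes "C_infty.subspace V" and "finite F" and "\<And>\<mu>. \<mu> \<in> F \<Longrightarrow> 0 < \<mu> \<and> exp_fun \<mu> \<in> V" and "0 < c"
  shows "\<exists>g\<in>V. norm (exp_fun c - g) \<le> (\<Prod>\<mu>\<in>F. \<bar>1 - c / \<mu>\<bar>)"
proof -
  obtain a where a: "\<And>t. t \<ge> 0 \<Longrightarrow>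
      \<bar>exp (- c * t) - (\<Sum>\<mu>\<in>F. a \<mu> * exp (- \<mu> * t))\<bar> \<le> (\<Prod>\<mu>\<in>F. \<bar>1 - c / \<mu>\<bar>)"
    using exp_approx_finite_set[of F c] assms by auto
  define g :: "'a C_infty" where "g = (\<Sum>\<mu>\<in>F. c_scale (of_real (a \<mu>)) (exp_fun \<mu>))"
  have "g \<in> V"
    unfolding g_def using assms by (auto intro!: C_infty.subspace_sum C_infty.subspace_scale)
  moreover have "norm (exp_fun c - g) \<le> (\<Prod>\<mu>\<in>F. \<bar>1 - c / \<mu>\<bar>)"
  proof (rule C_infty_norm_least)
    fix t :: real assume t: "0 \<le> t"
    have "c_apply (exp_fun c - g) t = of_real (exp (- c * t) - (\<Sum>\<mu>\<in>F. a \<mu> * exp (- \<mu> * t)))"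
      using assms t by (simp add: g_def minus_C_infty.rep_eq c_apply_sum c_scale.rep_eq c_apply_exp_fun)
    then show "norm (c_apply (exp_fun c - g) t) \<le> (\<Prod>\<mu>\<in>F. \<bar>1 - c / \<mu>\<bar>)"
      using a[OF t] by (simp only: norm_of_real)
  qed
  ultimately show ?thesis by blast
qed

section \<open>Asymptotic approximation by a family of subspaces\<close>

text \<open>The filter is a parameter so that the notion covers both the limit \<beta> to infinity
  and, for a constant family, the ordinary closure.\<close>

definition asymp_approx :: "'i filter \<Rightarrow> ('i \<Rightarrow> 'b::real_normed_vector set) \<Rightarrow> 'b set" where
  "asymp_approx F X = {x. \<forall>e>0. \<forall>\<^sub>F l in F. \<exists>g\<in>X l. norm (x - g) < e}"

lemma closed_asymp_approx: "closed (asymp_approx F X)"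
proof -
  have "x \<in> asymp_approx F X" if x: "x \<in> closure (asymp_approx F X)" for x
    unfolding asymp_approx_def
  proof (intro CollectI allI impI)
    fix e :: real assume "0 < e"
    then obtain y where y: "y \<in> asymp_approx F X" "norm (x - y) < e / 2"
      using x unfolding closure_approachable by (metis dist_commute dist_norm half_gt_zero)
    from y(1) \<open>0 < e\<close> have "\<forall>\<^sub>F l in F. \<exists>g\<in>X l. norm (y - g) < e / 2"
      unfolding asymp_approx_def using half_gt_zero by blast
    then show "\<forall>\<^sub>F l in F. \<exists>g\<in>X l. norm (x - g) < e"
    proof eventually_elim
      case (elim l)
      then obtain g where "g \<in> X l" "norm (y - g) < e / 2" by blast
      then show ?case using y(2) norm_triangle_ineq[of "x - y" "y - g"] by (intro bexI[of _ g]) auto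
    qed
  qed
  then show ?thesis by (metis closure_subset closure_closed subsetI subset_antisym closed_closure)
qed

lemma subspace_asymp_approx:
  fixes X :: "'i \<Rightarrow> 'a::real_normed_field C_infty set"
  assumes X: "\<forall>\<^sub>F l in F. C_infty.subspace (X l)"
  shows "C_infty.subspace (asymp_approx F X)"
proof (rule C_infty.subspaceI)
  have "\<forall>\<^sub>F l in F. \<exists>g\<in>X l. norm (0 - g) < e" if "e > 0" for e
    using X by eventually_elim (use that C_infty.subspace_0 in force)
  then show "0 \<in> asymp_approx F X" by (simp add: asymp_approx_def)
next
  fix x y assume xy: "x \<in> asymp_approx F X" "y \<in> asymp_approx F X"
  have "\<forall>\<^sub>F l in F. \<exists>g\<in>X l. norm (x + y - g) < e" if "e > 0" for e
  proof -
    have "\<forall>\<^sub>F l in F. \<exists>g\<in>X l. norm (x - g) < e / 2" "\<forall>\<^sub>F l in F. \<exists>g\<in>X l. norm (y - g) < e / 2"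
      using xy that half_gt_zero unfolding asymp_approx_def by blast+
    with X show ?thesis
    proof eventually_elim
      case (elim l)
      then obtain g h where gh: "g \<in> X l" "h \<in> X l" "norm (x - g) < e / 2" "norm (y - h) < e / 2"
        by blast
      then have "norm (x + y - (g + h)) < e"
        using norm_triangle_ineq[of "x - g" "y - h"] by (simp add: algebra_simps)
      with gh show ?case using C_infty.subspace_add[OF elim(1)] by blast
    qed
  qed
  then show "x + y \<in> asymp_approx F X" by (simp add: asymp_approx_def)
next
  fix c x assume x: "x \<in> asymp_approx F X"
  have "\<forall>\<^sub>F l in F. \<exists>g\<in>X l. norm (c_scale c x - g) < e" if "e > 0" for e
  proof -
    have "0 < e / (norm c + 1)" using that by (simp add: add_nonneg_pos)
    then have "\<forall>\<^sub>F l in F. \<exists>g\<in>X l. norm (x - g) < e / (norm c + 1)"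
      using x by (simp add: asymp_approx_def)
    with X show ?thesis
    proof eventually_elim
      case (elim l)
      then obtain g where g: "g \<in> X l" "norm (x - g) < e / (norm c + 1)" by blast
      have "norm (c_scale c x - c_scale c g) = norm c * norm (x - g)"
        by (simp add: norm_c_scale flip: C_infty.scale_right_diff_distrib)
      also have "\<dots> \<le> (norm c + 1) * norm (x - g)" by (simp add: distrib_right)
      also have "\<dots> < e" using g(2) by (simp add: pos_less_divide_eq add_nonneg_pos mult.commute)
      finally show ?case using g(1) C_infty.subspace_scale[OF elim(1)] by blast
    qed
  qed
  then show "c_scale c x \<in> asymp_approx F X" by (simp add: asymp_approx_def)
qed

text \<open>With this, closures of subspaces are subspaces for \<open>c_scale\<close> by
  \<open>subspace_asymp_approx\<close>.\<close>

lemma closure_eq_asymp_approx: "closure V = asymp_approx sequentially (\<lambda>_. V)"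
  by (auto simp: asymp_approx_def closure_approachable dist_norm norm_minus_commute)

lemma subspace_Exp_space: "C_infty.subspace (Exp_space a K)"
  unfolding Exp_space_def closure_eq_asymp_approx
  by (intro subspace_asymp_approx always_eventually allI C_infty.subspace_span)

lemma exp_fun_in_Exp_space: "k \<in> K \<Longrightarrow> exp_fun (a k) \<in> Exp_space a K"
  unfolding Exp_space_def by (meson C_infty.span_base closure_subset imageI subsetD)

section \<open>Density of the exponentials\<close>

lemma exp_fun_in_closed_subspace:
  fixes V :: "'a::real_normed_field C_infty set"
  assumes V: "C_infty.subspace V" "closed V" and "0 < \<delta>"
    and small: "\<And>c. 0 < c \<Longrightarrow> c \<le> \<delta> \<Longrightarrow> exp_fun c \<in> V" and "0 < c"
  shows "exp_fun c \<in> V"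
proof -
  have step: "exp_fun c \<in> V" if d: "0 < d" "\<And>c. 0 < c \<Longrightarrow> c \<le> d \<Longrightarrow> exp_fun c \<in> V"
    and c: "0 < c" "c \<le> 3 / 2 * d" for c d
  proof (cases "c \<le> d")
    case True
    then show ?thesis using d c by blast
  next
    case False
    have "\<exists>g\<in>V. dist g (exp_fun c) < e" if "e > 0" for e
    proof -
      obtain N where N: "(2 / 3 :: real) ^ N < e"
        using real_arch_pow_inv[of e "2/3"] \<open>e > 0\<close> by auto
      have "infinite {9 / 10 * d .. d}" using \<open>0 < d\<close> by (simp add: infinite_Icc)
      \<comment> \<open>For \<open>d < c \<le> 3 / 2 * d\<close> and \<mu> in this interval,
        \<open>c / \<mu>\<close> lies between 1 and (3/2) / (9/10) = 5/3. Each of the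
        \<open>N\<close> factors is thus at most 2/3.\<close>
      then obtain F where F: "finite F" "card F = N" "F \<subseteq> {9 / 10 * d .. d}"
        using infinite_arbitrarily_large by blast
      have mem: "0 < \<mu> \<and> exp_fun \<mu> \<in> V" if "\<mu> \<in> F" for \<mu>
        using that F(3) d by (force intro!: d(2))
      then obtain g where g: "g \<in> V" "norm (exp_fun c - g) \<le> (\<Prod>\<mu>\<in>F. \<bar>1 - c / \<mu>\<bar>)"
        using exp_fun_approx_subspace[OF V(1) F(1) _ c(1)] by blast
      have "(\<Prod>\<mu>\<in>F. \<bar>1 - c / \<mu>\<bar>) \<le> (\<Prod>\<mu>\<in>F. 2 / 3)"
      proof (rule prod_mono)
        fix \<mu> assume "\<mu> \<in> F"
        then have "9 / 10 * d \<le> \<mu>" "\<mu> \<le> d" using F(3) by auto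
        then have "1 \<le> c / \<mu>" "c / \<mu> \<le> 5 / 3"
          using False d(1) c by (auto simp: pos_le_divide_eq pos_divide_le_eq)
        then show "0 \<le> \<bar>1 - c / \<mu>\<bar> \<and> \<bar>1 - c / \<mu>\<bar> \<le> 2 / 3" by auto
      qed
      also have "\<dots> < e" using N F by simp
      finally show ?thesis using g by (force simp: dist_norm norm_minus_commute)
    qed
    then show ?thesis using V(2) by (metis closure_approachable closure_closed)
  qed
  have all: "exp_fun c \<in> V" if "0 < c" "c \<le> (3 / 2) ^ n * \<delta>" for n c
    using that
  proof (induction n arbitrary: c)
    case 0
    then show ?case using small by simp
  next
    case (Suc n)
    show ?case
      by (rule step[of "(3 / 2) ^ n * \<delta>"]) (use Suc \<open>0 < \<delta>\<close> in \<open>auto simp: mult.assoc\<close>)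
  qed
  obtain n where "c / \<delta> < (3 / 2) ^ n" using real_arch_pow[of "3/2" "c / \<delta>"] by auto
  then show ?thesis using all[of c n] \<open>0 < c\<close> \<open>0 < \<delta>\<close> by (simp add: pos_divide_less_eq)
qed

lemma real_approx_exp_sum:
  fixes f :: "real \<Rightarrow> real"
  assumes f: "continuous_on {0..} f" "(f \<longlongrightarrow> 0) at_top" and "0 < e"
  shows "\<exists>a n. \<forall>t\<ge>0. \<bar>f t - (\<Sum>i=1..n. a i * exp (- real i * t))\<bar> < e"
proof -
  \<comment> \<open>the substitution \<open>x = exp (- t)\<close>\<close>
  define g where "g x = (if x = 0 then 0 else f (- ln x))" for x
  have cont: "continuous_on {0..1} g"
    unfolding continuous_on_eq_continuous_within
  proof
    fix x :: real assume x: "x \<in> {0..1}"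
    show "continuous (at x within {0..1}) g"
    proof (cases "x = 0")
      case True
      have "((\<lambda>x. f (- ln x)) \<longlongrightarrow> 0) (at_right 0)"
        by (rule filterlim_compose[OF f(2)])
          (auto intro: filterlim_compose[OF filterlim_uminus_at_top_at_bot ln_at_0])
      then have "(g \<longlongrightarrow> 0) (at_right 0)"
        by (rule Lim_transform_eventually)
          (auto simp: g_def eventually_at_filter)
      then show ?thesis using True
        by (auto simp: continuous_within g_def at_within_Icc_at_right)
    next
      case False
      have "continuous_on {0<..1} (\<lambda>x. f (- ln x))"
        by (intro continuous_on_compose2[OF f(1)] continuous_intros) auto
      then have "continuous_on {0<..1} g"
        by (rule continuous_on_eq) (auto simp: g_def)
      then have "continuous (at x within {0<..1}) g"
        using x False by (auto simp: continuous_on_eq_continuous_within)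
      moreover have "at x within {0<..1} = at x within {0..1}"
        using x False by (intro at_within_nhd[of x "{0<..}"]) auto
      ultimately show ?thesis by simp
    qed
  qed
  obtain p where p: "real_polynomial_function p" "\<And>x. x \<in> {0..1} \<Longrightarrow> \<bar>g x - p x\<bar> < e / 2"
    using Stone_Weierstrass_real_polynomial_function[OF compact_Icc cont, of "e / 2"] \<open>0 < e\<close> by auto
  obtain a n where an: "p = (\<lambda>x. \<Sum>i\<le>n. a i * x ^ i)"
    using p(1) unfolding real_polynomial_function_iff_sum by blast
  have split: "p x = a 0 + (\<Sum>i=1..n. a i * x ^ i)" for x
    by (simp add: an atMost_atLeast0 sum.atLeast_Suc_atMost)
  \<comment> \<open>A constant is not in the span of decaying exponentials. Since
    \<open>g 0 = 0\<close>, dropping the constant term of \<open>p\<close> costs less than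
    \<open>e / 2\<close>.\<close>
  have "\<bar>a 0\<bar> < e / 2" using p(2)[of 0] by (simp add: split g_def)
  have "\<bar>f t - (\<Sum>i=1..n. a i * exp (- real i * t))\<bar> < e" if "t \<ge> 0" for t
  proof -
    have "(\<Sum>i=1..n. a i * exp (- real i * t)) = p (exp (- t)) - a 0"
      by (simp add: split flip: exp_of_nat_mult)
    moreover have "g (exp (- t)) = f t" by (simp add: g_def)
    moreover have "\<bar>g (exp (- t)) - p (exp (- t))\<bar> < e / 2" using p(2) that by simp
    ultimately show ?thesis using \<open>\<bar>a 0\<bar> < e / 2\<close> by linarith
  qed
  then show ?thesis by blast
qed

text \<open>The sort of \<open>'a\<close> treats real and complex values together: each coordinate
  is approximated by a real exponential sum.\<close>

lemma closed_subspace_exp_fun_eq_UNIV: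
  fixes V :: "'a::{real_normed_field,euclidean_space} C_infty set"
  assumes V: "C_infty.subspace V" "closed V" and exps: "\<And>c. 0 < c \<Longrightarrow> exp_fun c \<in> V"
  shows "V = UNIV"
proof -
  have "\<exists>g\<in>V. dist g f < e" if "e > 0" for f e
  proof -
    define d where "d = e / (2 * real DIM('a))"
    have "0 < d" using that by (simp add: d_def)
    have "\<exists>a n. \<forall>t\<ge>0. \<bar>c_apply f t \<bullet> b - (\<Sum>i=1..n. a i * exp (- real i * t))\<bar> < d" for b
    proof (rule real_approx_exp_sum[OF _ _ \<open>0 < d\<close>])
      show "((\<lambda>t. c_apply f t \<bullet> b) \<longlongrightarrow> 0) at_top"
        using tendsto_inner[OF c_apply_lim tendsto_const, of f b] by simp
    qed (intro continuous_intros c_apply_cont)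
    then obtain a n where an: "\<And>b t. t \<ge> 0 \<Longrightarrow>
        \<bar>c_apply f t \<bullet> b - (\<Sum>i=1..n b. a b i * exp (- real i * t))\<bar> < d"
      by metis
    \<comment> \<open>A basis vector \<open>b\<close> is itself a scalar of the field
      \<open>'a\<close>, so \<open>a b i *\<^sub>R b\<close> is an admissible coefficient.\<close>
    define g where "g = (\<Sum>b\<in>Basis. \<Sum>i=1..n b. c_scale (a b i *\<^sub>R b) (exp_fun (real i)))"
    have "g \<in> V" unfolding g_def
      using V(1) exps by (auto intro!: C_infty.subspace_sum C_infty.subspace_scale)
    moreover have "norm (f - g) \<le> e / 2"
    proof (rule C_infty_norm_least)
      fix t :: real assume t: "0 \<le> t"
      have "c_apply g t = (\<Sum>b\<in>Basis. (\<Sum>i=1..n b. a b i * exp (- real i * t)) *\<^sub>R b)"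
        unfolding g_def c_apply_sum scaleR_left.sum
        by (intro sum.cong refl)
          (auto simp: c_scale.rep_eq c_apply_exp_fun t scaleR_conv_of_real mult_ac)
      moreover have "c_apply f t = (\<Sum>b\<in>Basis. (c_apply f t \<bullet> b) *\<^sub>R b)"
        by (simp add: euclidean_representation)
      ultimately have "c_apply (f - g) t =
          (\<Sum>b\<in>Basis. (c_apply f t \<bullet> b - (\<Sum>i=1..n b. a b i * exp (- real i * t))) *\<^sub>R b)"
        by (simp add: minus_C_infty.rep_eq scaleR_left_diff_distrib sum_subtractf)
      also have "norm \<dots> \<le> (\<Sum>b\<in>(Basis::'a set). d)"
        using an[OF t] by (intro sum_norm_le) (auto intro: less_imp_le)
      also have "\<dots> = e / 2" by (simp add: d_def)
      finally show "norm (c_apply (f - g) t) \<le> e / 2" .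
    qed
    ultimately show ?thesis using that by (force simp: dist_norm norm_minus_commute)
  qed
  then have "f \<in> closure V" for f
    by (simp add: closure_approachable)
  then show ?thesis using V(2) by auto
qed

section \<open>From approximation to absolute representation\<close>

lemma greedy_representation:
  fixes X :: "'i \<Rightarrow> 'b::banach set" and \<beta> :: "'i \<Rightarrow> real"
  assumes X0: "\<And>l. l \<in> L \<Longrightarrow> 0 \<in> X l"
    and approx: "\<And>x e B. 0 < e \<Longrightarrow> \<exists>l\<in>L. B < \<beta> l \<and> (\<exists>g\<in>X l. norm (x - g) < e)"
  shows "\<exists>y. (\<forall>l\<in>L. y l \<in> X l) \<and> (\<lambda>l. norm (y l)) summable_on L \<and> (y has_sum x) L"
proof -
  \<comment> \<open>A state holds the current remainder, the chosen index and the approximant taken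
    from its space.\<close>
  let ?P = "\<lambda>n (r, l, g). (n = 0 \<longrightarrow> r = x) \<and> l \<in> L \<and> g \<in> X l \<and> norm (r - g) < (1/2) ^ n"
  let ?Q = "\<lambda>n (r, l, g) (r', l', g'). r' = r - g \<and> \<beta> l < \<beta> l'"
  have "\<exists>s. \<forall>n. ?P n (s n) \<and> ?Q n (s n) (s (Suc n))"
  proof (rule dependent_nat_choice)
    show "\<exists>z. ?P 0 z" using approx[of 1 0 x] by auto
    show "\<exists>z'. ?P (Suc n) z' \<and> ?Q n z z'" if "?P n z" for z n
    proof -
      obtain r l g where z: "z = (r, l, g)" by (cases z)
      obtain l' g' where "l' \<in> L" "\<beta> l < \<beta> l'" "g' \<in> X l'" "norm (r - g - g') < (1/2) ^ Suc n"
        using approx[of "(1/2) ^ Suc n" "\<beta> l" "r - g"] by auto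
      then show ?thesis unfolding z by (intro exI[of _ "(r - g, l', g')"]) simp
    qed
  qed
  then obtain s where s: "\<forall>n. ?P n (s n) \<and> ?Q n (s n) (s (Suc n))" ..
  define r where "r n = fst (s n)" for n
  define l where "l n = fst (snd (s n))" for n
  define g where "g n = snd (snd (s n))" for n
  have props: "r 0 = x" "l n \<in> L" "g n \<in> X (l n)" "norm (r n - g n) < (1/2) ^ n"
    "r (Suc n) = r n - g n" "\<beta> (l n) < \<beta> (l (Suc n))" for n
    using spec[OF s, of 0] spec[OF s, of n] by (simp_all add: r_def l_def g_def split_beta)
  \<comment> \<open>No index may be used twice, as each subspace contributes a single vector;
    increasing \<beta> ensures this.\<close>
  have "strict_mono (\<lambda>n. \<beta> (l n))" using props(6) by (simp add: strict_mono_Suc_iff)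
  then have "inj (\<beta> \<circ> l)" by (simp add: strict_mono_imp_inj_on o_def)
  then have inj: "inj l" by (rule inj_on_imageI2)
  have rs: "norm (r (Suc n)) < (1/2) ^ n" for n using props(4,5) by simp
  have part: "(\<Sum>j<n. g j) = x - r n" for n
    by (induction n) (simp_all add: props)
  have "(\<lambda>n. r (Suc n)) \<longlonglongrightarrow> 0"
  proof (rule Lim_null_comparison)
    show "(\<lambda>n. (1/2 :: real) ^ n) \<longlonglongrightarrow> 0" by (rule LIMSEQ_realpow_zero) auto
  qed (use rs in \<open>auto intro!: always_eventually less_imp_le\<close>)
  then have "r \<longlonglongrightarrow> 0" by (rule LIMSEQ_imp_Suc)
  then have gx: "g sums x"
    unfolding sums_def part using tendsto_diff[OF tendsto_const, of r 0 _ x] by simp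
  \<comment> \<open>The shift by one skips \<open>g 0\<close>, whose size depends on
    \<open>x\<close>; later terms are differences of geometrically small remainders.\<close>
  have "summable (\<lambda>n. norm (g (Suc n)))"
  proof (rule summable_comparison_test')
    show "summable (\<lambda>n. 2 * (1/2 :: real) ^ n)" by (intro summable_mult summable_geometric) auto
    show "norm (norm (g (Suc n))) \<le> 2 * (1/2) ^ n" for n
    proof -
      have "norm (g (Suc n)) = norm (r (Suc n) - r (Suc (Suc n)))"
        by (simp add: props(5)[of "Suc n"])
      also have "\<dots> \<le> norm (r (Suc n)) + norm (r (Suc (Suc n)))"
        by (rule norm_triangle_ineq4)
      also have "\<dots> \<le> (1/2) ^ n + (1/2) ^ Suc n"
        using rs[of n] rs[of "Suc n"] by (intro add_mono less_imp_le)
      also have "\<dots> \<le> 2 * (1/2) ^ n" by simp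
      finally show ?thesis by simp
    qed
  qed
  then have gsum: "summable (\<lambda>n. norm (g n))" by (rule summable_Suc_iff[THEN iffD1])
  define y where "y i = (if i \<in> range l then g (inv l i) else 0)" for i
  have yl: "y (l n) = g n" for n using inj by (simp add: y_def)
  have "y i \<in> X i" if "i \<in> L" for i
    using that X0 props(3) yl by (cases "i \<in> range l") (auto simp: y_def)
  moreover have "(y has_sum x) L"
  proof -
    have "(g has_sum x) UNIV" by (rule norm_summable_imp_has_sum[OF gsum gx])
    then have "(y has_sum x) (range l)"
      using has_sum_reindex[OF inj, of y x] by (simp add: o_def yl)
    then show ?thesis
      by (rule has_sum_cong_neutral[THEN iffD1, rotated -1]) (use props(2) in \<open>auto simp: y_def\<close>)
  qed
  moreover have "(\<lambda>i. norm (y i)) summable_on L"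
  proof -
    have "(\<lambda>n. norm (g n)) summable_on UNIV"
      by (rule norm_summable_imp_summable_on) (use gsum in simp)
    then have "(\<lambda>i. norm (y i)) summable_on range l"
      using summable_on_reindex[OF inj, of "\<lambda>i. norm (y i)"] by (simp add: o_def yl)
    then show ?thesis
      by (rule summable_on_cong_neutral[THEN iffD1, rotated -1]) (use props(2) in \<open>auto simp: y_def\<close>)
  qed
  ultimately show ?thesis by blast
qed

section \<open>Combining the parts for the exponential subspaces\<close>

lemma arfs_Exp_space:
  fixes \<Lambda> :: "'i set" and n :: "'i \<Rightarrow> enat" and \<alpha> :: "'i \<Rightarrow> nat \<Rightarrow> real" and \<beta> :: "'i \<Rightarrow> real"
  assumes n: "\<And>l. l \<in> \<Lambda> \<Longrightarrow> 1 \<le> n l"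
    and mono: "\<And>l. l \<in> \<Lambda> \<Longrightarrow> strict_mono_on (idx_set (n l)) (\<alpha> l)"
    and pos: "\<And>l k. l \<in> \<Lambda> \<Longrightarrow> k \<in> idx_set (n l) \<Longrightarrow> 0 < \<alpha> l k"
    and sum: "\<And>l. l \<in> \<Lambda> \<Longrightarrow> ((\<lambda>k. 1 / \<alpha> l k) has_sum \<beta> l) (idx_set (n l))"
    and inf: "0 < (INF l\<in>\<Lambda>. \<alpha> l 1)"
    and unb: "\<not> (\<exists>C. \<forall>l\<in>\<Lambda>. \<beta> l \<le> C)"
  shows "arfs c_scale \<Lambda> (\<lambda>l. Exp_space (\<alpha> l) (idx_set (n l)) :: 'a::{real_normed_field,euclidean_space} C_infty set)"
proof -
  define X where "X l = (Exp_space (\<alpha> l) (idx_set (n l)) :: 'a C_infty set)" for l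
  define \<delta> where "\<delta> = (INF l\<in>\<Lambda>. \<alpha> l 1)"
  have one: "1 \<in> idx_set (n l)" if "l \<in> \<Lambda>" for l
    using n[OF that] by (simp add: idx_set_def one_enat_def)
  have \<delta>_le: "\<delta> \<le> \<alpha> l k" if "l \<in> \<Lambda>" "k \<in> idx_set (n l)" for l k
  proof -
    \<comment> \<open>A real infimum is a lower bound only for a set bounded below; positivity
      supplies the bound 0.\<close>
    have "\<delta> \<le> \<alpha> l 1" unfolding \<delta>_def
      using pos one that by (intro cINF_lower bdd_belowI2[of _ 0]) (auto intro: less_imp_le)
    also have "\<dots> \<le> \<alpha> l k"
    proof (cases "k = 1")
      case False
      then have "1 < k" using that by (simp add: idx_set_def)
      then show ?thesis using strict_mono_onD[OF mono] one that by (meson less_imp_le)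
    qed simp
    finally show ?thesis .
  qed
  \<comment> \<open>the filter of \<open>\<beta> l \<rightarrow> \<infinity>\<close> within \<open>\<Lambda>\<close>\<close>
  define F where "F = inf (principal \<Lambda>) (filtercomap \<beta> at_top)"
  have ev: "eventually P F \<longleftrightarrow> (\<exists>B. \<forall>l\<in>\<Lambda>. B < \<beta> l \<longrightarrow> P l)" for P
    unfolding F_def inf_commute[of "principal \<Lambda>"] eventually_inf_principal
    by (auto simp: eventually_filtercomap_at_top_dense)
  have subX: "C_infty.subspace (X l)" for l
    unfolding X_def by (rule subspace_Exp_space)
  have "exp_fun c \<in> asymp_approx F X" if c: "0 < c" "c \<le> \<delta>" for c
    unfolding asymp_approx_def ev
  proof (intro CollectI allI impI exI ballI)
    \<comment> \<open>The threshold for \<beta> is where \<open>exp (- c * \<beta> l)\<close> falls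
      below \<open>e\<close>.\<close>
    fix e :: real and l assume "0 < e" and l: "l \<in> \<Lambda>" "- ln e / c < \<beta> l"
    \<comment> \<open>The index set may be infinite, but the product bound needs finitely many
      exponents: some finite partial sum already exceeds the threshold.\<close>
    have "\<forall>\<^sub>F K in finite_subsets_at_top (idx_set (n l)). - ln e / c < (\<Sum>k\<in>K. 1 / \<alpha> l k)"
      using sum[OF l(1)] l(2) unfolding has_sum_def by (rule order_tendstoD)
    then obtain K where K: "finite K" "K \<subseteq> idx_set (n l)" "- ln e / c < (\<Sum>k\<in>K. 1 / \<alpha> l k)"
      unfolding eventually_finite_subsets_at_top by blast
    have "inj_on (\<alpha> l) K"
      using strict_mono_on_imp_inj_on[OF mono[OF l(1)]] K(2) inj_on_subset by blast
    obtain g where g: "g \<in> X l" "norm (exp_fun c - g) \<le> (\<Prod>\<mu>\<in>\<alpha> l ` K. \<bar>1 - c / \<mu>\<bar>)"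
      using exp_fun_approx_subspace[OF subX _ _ c(1), of "\<alpha> l ` K" l] K(1,2) pos[OF l(1)]
      by (auto simp: X_def intro!: exp_fun_in_Exp_space)
    note g(2)
    also have "(\<Prod>\<mu>\<in>\<alpha> l ` K. \<bar>1 - c / \<mu>\<bar>) = (\<Prod>k\<in>K. \<bar>1 - c / \<alpha> l k\<bar>)"
      using \<open>inj_on (\<alpha> l) K\<close> by (simp add: prod.reindex)
    also have "(\<Prod>k\<in>K. \<bar>1 - c / \<alpha> l k\<bar>) \<le> (\<Prod>k\<in>K. exp (- c * (1 / \<alpha> l k)))"
    proof (rule prod_mono)
      fix k assume "k \<in> K"
      then have "c / \<alpha> l k \<le> 1"
        using K(2) c \<delta>_le[OF l(1)] pos[OF l(1)] by (fastforce simp: pos_divide_le_eq)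
      then show "0 \<le> \<bar>1 - c / \<alpha> l k\<bar> \<and> \<bar>1 - c / \<alpha> l k\<bar> \<le> exp (- c * (1 / \<alpha> l k))"
        using exp_ge_add_one_self[of "- (c / \<alpha> l k)"] by simp
    qed
    also have "\<dots> = exp (- c * (\<Sum>k\<in>K. 1 / \<alpha> l k))"
      by (simp only: exp_sum[OF K(1)] sum_distrib_left)
    also have "\<dots> < exp (ln e)"
      using K(3) c(1) by (simp add: minus_less_iff[of "ln e / c"] minus_less_iff[of _ "ln e"]
          pos_divide_less_eq pos_less_divide_eq mult.commute)
    finally show "\<exists>g\<in>X l. norm (exp_fun c - g) < e"
      using g(1) \<open>0 < e\<close> by auto
  qed
  moreover have subD: "C_infty.subspace (asymp_approx F X)"
    by (intro subspace_asymp_approx always_eventually allI subX)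
  ultimately have "exp_fun c \<in> asymp_approx F X" if "0 < c" for c
    using inf that exp_fun_in_closed_subspace[OF subD closed_asymp_approx, of \<delta> c]
    by (auto simp: \<delta>_def)
  then have "asymp_approx F X = UNIV"
    by (rule closed_subspace_exp_fun_eq_UNIV[OF subD closed_asymp_approx])
  then have app: "\<exists>B. \<forall>l\<in>\<Lambda>. B < \<beta> l \<longrightarrow> (\<exists>g\<in>X l. norm (x - g) < e)" if "0 < e" for x e
    using that unfolding asymp_approx_def ev by blast
  have "\<exists>y. (\<forall>l\<in>\<Lambda>. y l \<in> X l) \<and> (\<lambda>l. norm (y l)) summable_on \<Lambda> \<and> (y has_sum x) \<Lambda>" for x
  proof (rule greedy_representation)
    show "0 \<in> X l" for l using subX by (rule C_infty.subspace_0)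
    show "\<exists>l\<in>\<Lambda>. B < \<beta> l \<and> (\<exists>g\<in>X l. norm (x - g) < e)" if e: "0 < e" for x e B
    proof -
      obtain B' where B': "\<forall>l\<in>\<Lambda>. B' < \<beta> l \<longrightarrow> (\<exists>g\<in>X l. norm (x - g) < e)" using app[OF e] by blast
      \<comment> \<open>Exceeding \<open>B\<close> keeps the index new in the greedy choice,
        exceeding \<open>B'\<close> makes the approximation good enough.\<close>
      obtain l where "l \<in> \<Lambda>" "max B B' < \<beta> l" using unb by (meson not_le)
      then show ?thesis using B' by auto
    qed
  qed
  moreover have "closed (X l)" for l by (simp add: X_def Exp_space_def)
  ultimately show ?thesis
    unfolding arfs_def using subX by (simp add: X_def)
qed

theorem theorem7p1:
  fixes \<Lambda> :: "'i set" and n :: "'i \<Rightarrow> enat" and \<alpha> :: "'i \<Rightarrow> nat \<Rightarrow> real" and \<beta> :: "'i \<Rightarrow> real"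
  assumes "\<Lambda> \<noteq> {}"
    and "\<And>l. l \<in> \<Lambda> \<Longrightarrow> 1 \<le> n l"
    and "\<And>l. l \<in> \<Lambda> \<Longrightarrow> strict_mono_on (idx_set (n l)) (\<alpha> l)"
    and "\<And>l k. l \<in> \<Lambda> \<Longrightarrow> k \<in> idx_set (n l) \<Longrightarrow> 0 < \<alpha> l k"
    and "\<And>l. l \<in> \<Lambda> \<Longrightarrow> ((\<lambda>k. 1 / \<alpha> l k) has_sum \<beta> l) (idx_set (n l))"
    and "0 < (INF l\<in>\<Lambda>. \<alpha> l 1)"
    and "\<not> (\<exists>C. \<forall>l\<in>\<Lambda>. \<beta> l \<le> C)"
  shows "arfs c_scale \<Lambda> (\<lambda>l. Exp_space (\<alpha> l) (idx_set (n l)) :: real C_infty set) \<and>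
         arfs c_scale \<Lambda> (\<lambda>l. Exp_space (\<alpha> l) (idx_set (n l)) :: complex C_infty set)"
  by (intro conjI arfs_Exp_space[where \<beta> = \<beta>] assms(2-))

end
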